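(* Let $p\in\mathbb{R}\setminus\{0\}$ and $0<a<b$. If $f:[a,b]\to\mathbb{R}$ is symmetrized $p$-convex on the interval $[a,b]$ and $w:[a,b]\to[0,\infty)$ is integrable on $[a,b]$, then $$f\left(\left[\frac{a^{p}+b^{p}}{2}\right]^{1/p}\right)\int_{a}^{b}\frac{w(x)}{x^{1-p}}\,dx\le \int_{a}^{b}\frac{w(x)P_{(f;p)}(x)}{x^{1-p}}\,dx\le \frac{f(a)+f(b)}{2}\int_{a}^{b}\frac{w(x)}{x^{1-p}}\,dx.$$ Moreover, if $w$ is $p$-symmetric with respect to $\left[\frac{a^{p}+b^{p}}{2}\right]^{1/p}$ on $[a,b]$, i.e. $w(x)=w\left([a^{p}+b^{p}-x^{p}]^{1/p}\right)$ for all $x\in[a,b]$, then $$f\left(\left[\frac{a^{p}+b^{p}}{2}\right]^{1/p}\right)\int_{a}^{b}\frac{w(x)}{x^{1-p}}\,dx\le \int_{a}^{b}\frac{w(x)f(x)}{x^{1-p}}\,dx\le \frac{f(a)+f(b)}{2}\int_{a}^{b}\frac{w(x)}{x^{1-p}}\,dx.$$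
   Context: Let $p\in\mathbb{R}\setminus\{0\}$. A function $h:I\to\mathbb{R}$ on a real interval $I\subseteq(0,\infty)$ is called $p$-convex if $h\left([tx^{p}+(1-t)y^{p}]^{1/p}\right)\le t\,h(x)+(1-t)\,h(y)$ for all $x,y\in I$ and $t\in[0,1]$. For $f:[a,b]\to\mathbb{R}$ with $[a,b]\subseteq(0,\infty)$, the $p$-symmetrical transform of $f$ on $[a,b]$ is the function $P_{(f;p)}(x)=\frac12\left[f(x)+f\left([a^{p}+b^{p}-x^{p}]^{1/p}\right)\right]$, $x\in[a,b]$. The function $f$ is called symmetrized $p$-convex on $[a,b]$ if $P_{(f;p)}$ is $p$-convex on $[a,b]$.
   Formalization: In the "Moreover" part, w(x)f(x)/x^{1-p} is additionally assumed Lebesgue integrable on [a,b], so that the written integral exists; symmetrized p-convexity of f alone does not guarantee this (f may even be nonmeasurable). *)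

theory Defs
  imports "HOL-Analysis.Analysis"
begin

(* All notions below are meant for p nonzero and intervals contained in {0<..}, where powr is
   the usual real power; on {a..b} the map x |-> (a powr p + b powr p - x powr p) powr (1 / p)
   is then an involution exchanging a and b. *)

definition p_convex_on :: "real \<Rightarrow> real set \<Rightarrow> (real \<Rightarrow> real) \<Rightarrow> bool" where
  "p_convex_on p I h \<longleftrightarrow>
     (\<forall>x\<in>I. \<forall>y\<in>I. \<forall>t\<in>{0..1}.
        h ((t * x powr p + (1 - t) * y powr p) powr (1 / p)) \<le> t * h x + (1 - t) * h y)"

definition p_symm_transform :: "real \<Rightarrow> real \<Rightarrow> real \<Rightarrow> (real \<Rightarrow> real) \<Rightarrow> real \<Rightarrow> real" where
  "p_symm_transform p a b f x =
     1 / 2 * (f x + f ((a powr p + b powr p - x powr p) powr (1 / p)))"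

definition symmetrized_p_convex_on :: "real \<Rightarrow> real \<Rightarrow> real \<Rightarrow> (real \<Rightarrow> real) \<Rightarrow> bool" where
  "symmetrized_p_convex_on p a b f \<longleftrightarrow> p_convex_on p {a..b} (p_symm_transform p a b f)"

definition p_symmetric_on :: "real \<Rightarrow> real \<Rightarrow> real \<Rightarrow> (real \<Rightarrow> real) \<Rightarrow> bool" where
  "p_symmetric_on p a b w \<longleftrightarrow>
     (\<forall>x\<in>{a..b}. w x = w ((a powr p + b powr p - x powr p) powr (1 / p)))"

end

theory Submission
  imports Defs
begin

text \<open>
  In the variable \<open>u = x powr p\<close> the transform \<open>P\<close> becomes a convex function that is symmetric about
  the midpoint of \<open>a powr p\<close> and \<open>b powr p\<close>. Such a function lies between its value at the midpoint
  and its common value at the end points; the first chain is the integral of these bounds against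
  the weight. For a \<open>p\<close>-symmetric \<open>w\<close>, the involution \<open>x \<mapsto> (a powr p + b powr p - x powr p) powr (1 / p)\<close>
  preserves the measure \<open>w x * x powr (p - 1) dx\<close>, so \<open>f\<close> and \<open>P\<close> have the same integral.
\<close>

section \<open>The substitution \<open>u = x powr p\<close> on \<open>{a..b}\<close>\<close>

locale p_interval =
  fixes p a b :: real
  assumes p_nz: "p \<noteq> 0" and a_pos: "0 < a" and a_less_b: "a < b"
begin

definition reflect :: "real \<Rightarrow> real" where
  "reflect x = (a powr p + b powr p - x powr p) powr (1 / p)"

text \<open>For p < 0 the power map is decreasing, so the order of \<open>a powr p\<close> and
  \<open>b powr p\<close> depends on the sign of p. With \<open>min\<close> and \<open>max\<close>
  the image of \<open>{a..b}\<close> is \<open>{lo..hi}\<close> in both cases.\<close>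

abbreviation lo :: real where "lo \<equiv> min (a powr p) (b powr p)"
abbreviation hi :: real where "hi \<equiv> max (a powr p) (b powr p)"

lemma pos_if_lo_le: "lo \<le> u \<Longrightarrow> 0 < u"
  by (rule order.strict_trans2[where b = lo]) (use a_pos a_less_b in auto)

lemma powr_root: "0 < x \<Longrightarrow> (x powr p) powr (1 / p) = x"
  using p_nz by (simp add: powr_powr)

lemma root_powr: "0 < u \<Longrightarrow> (u powr (1 / p)) powr p = u"
  using p_nz by (simp add: powr_powr)

lemma powr_mem: "x \<in> {a..b} \<Longrightarrow> x powr p \<in> {lo..hi}"
proof (cases "p > 0")
  case True
  assume "x \<in> {a..b}"
  then have "a powr p \<le> x powr p" "x powr p \<le> b powr p"
    using True a_pos by (auto intro!: powr_mono2)
  then show ?thesis by auto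
next
  case False
  assume "x \<in> {a..b}"
  then have "b powr p \<le> x powr p" "x powr p \<le> a powr p"
    using False a_pos by (auto intro!: powr_mono2')
  then show ?thesis by auto
qed

lemma powr_mem_open: "x \<in> {a<..<b} \<Longrightarrow> x powr p \<in> {lo<..<hi}"
proof -
  assume x: "x \<in> {a<..<b}"
  \<comment> \<open>Taking roots of an equality would give x = a or x = b.\<close>
  have "x powr p \<noteq> a powr p" "x powr p \<noteq> b powr p"
    using x a_pos a_less_b powr_root[of x] powr_root[of a] powr_root[of b] by force+
  moreover have "x powr p \<in> {lo..hi}" using x by (intro powr_mem) auto
  ultimately show ?thesis by (auto simp: min_def max_def split: if_splits)
qed

lemma root_mem: "u \<in> {lo..hi} \<Longrightarrow> u powr (1 / p) \<in> {a..b}"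
proof (cases "p > 0")
  case True
  assume u: "u \<in> {lo..hi}"
  have "a powr p \<le> b powr p" using True a_pos a_less_b by (intro powr_mono2) auto
  with u have "a powr p \<le> u" "u \<le> b powr p" by auto
  then have "(a powr p) powr (1 / p) \<le> u powr (1 / p)" "u powr (1 / p) \<le> (b powr p) powr (1 / p)"
    using True pos_if_lo_le[of u] u by (auto intro!: powr_mono2)
  then show ?thesis using powr_root a_pos a_less_b by auto
next
  case False
  assume u: "u \<in> {lo..hi}"
  have "b powr p \<le> a powr p" using False a_pos a_less_b by (intro powr_mono2') auto
  with u have "b powr p \<le> u" "u \<le> a powr p" by auto
  then have "(a powr p) powr (1 / p) \<le> u powr (1 / p)" "u powr (1 / p) \<le> (b powr p) powr (1 / p)"
    using False pos_if_lo_le[of u] u a_pos a_less_b by (auto intro!: powr_mono2')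
  then show ?thesis using powr_root a_pos a_less_b by auto
qed

section \<open>The reflection as an involution of \<open>{a..b}\<close>\<close>

lemma reflect_arg:
  assumes "x \<in> {a..b}"
  shows "a powr p + b powr p - x powr p \<in> {lo..hi}" "0 < a powr p + b powr p - x powr p"
proof -
  show mem: "a powr p + b powr p - x powr p \<in> {lo..hi}"
    using powr_mem[OF assms] by (auto simp: min_def max_def split: if_splits)
  show "0 < a powr p + b powr p - x powr p"
    by (rule pos_if_lo_le) (use mem in auto)
qed

lemma reflect_powr: "x \<in> {a..b} \<Longrightarrow> reflect x powr p = a powr p + b powr p - x powr p"
  unfolding reflect_def by (intro root_powr reflect_arg)

lemma reflect_mem: "x \<in> {a..b} \<Longrightarrow> reflect x \<in> {a..b}"
  unfolding reflect_def by (intro root_mem reflect_arg)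

lemma reflect_reflect: "x \<in> {a..b} \<Longrightarrow> reflect (reflect x) = x"
  using a_pos by (simp add: reflect_def[of "reflect x"] reflect_powr powr_root)

lemma reflect_image: "reflect ` {a..b} = {a..b}"
  using reflect_mem reflect_reflect by (force simp: image_iff)

lemma inj_on_reflect: "inj_on reflect {a..b}"
  by (rule inj_on_inverseI[where g = reflect]) (rule reflect_reflect)

lemma reflect_ends: "reflect a = b" "reflect b = a"
  using a_pos a_less_b powr_root by (auto simp: reflect_def)

section \<open>Change of variables under the reflection\<close>

lemma reflect_derivative:
  assumes "x \<in> {a..b}"
  shows "(reflect has_field_derivative - (x powr (p - 1) * reflect x powr (1 - p))) (at x)"
proof -
  let ?u = "a powr p + b powr p - x powr p"
  have x: "0 < x" using assms a_pos by simp
  have u: "0 < ?u" by (rule reflect_arg(2)[OF assms])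
  \<comment> \<open>The left side is what the chain rule yields;
    \<open>reflect x powr (1 - p)\<close> is \<open>?u powr (1 / p - 1)\<close>, because (1 - p) / p
    = 1 / p - 1.\<close>
  have "(1 / p) * ?u powr (1 / p - 1) * (0 - p * x powr (p - 1)) =
      - (x powr (p - 1) * reflect x powr (1 - p))"
    using p_nz by (simp add: reflect_def powr_powr diff_divide_distrib)
  \<comment> \<open>Both x and \<open>?u\<close> are positive, so the derivative is two-sided even
    at a and b.\<close>
  moreover have "(reflect has_field_derivative
      (1 / p) * ?u powr (1 / p - 1) * (0 - p * x powr (p - 1))) (at x)"
    unfolding reflect_def[abs_def]
    by (rule DERIV_chain2[where f = "\<lambda>z. z powr (1 / p)" and g = "\<lambda>x. a powr p + b powr p - x powr p",
        OF has_real_derivative_powr[OF u]])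
       (intro DERIV_diff DERIV_const has_real_derivative_powr x)
  ultimately show ?thesis by simp
qed

text \<open>The density \<open>1 / x powr (1 - p)\<close> is \<open>x powr (p - 1)\<close>, up to a
  constant the derivative of \<open>x powr p\<close>. In the variable u the measure is thus a
  multiple of Lebesgue measure, which an affine reflection preserves.\<close>

lemma reflect_change_of_variables:
  fixes g :: "real \<Rightarrow> real"
  assumes "set_integrable lebesgue {a..b} (\<lambda>x. g x / x powr (1 - p))"
  shows "set_integrable lebesgue {a..b} (\<lambda>x. g (reflect x) / x powr (1 - p))"
    and "(LINT x:{a..b}|lebesgue. g (reflect x) / x powr (1 - p)) =
         (LINT x:{a..b}|lebesgue. g x / x powr (1 - p))"
proof -
  let ?F = "\<lambda>x. g x / x powr (1 - p)"
  let ?d = "\<lambda>x. - (x powr (p - 1) * reflect x powr (1 - p))"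
  \<comment> \<open>The factor \<open>reflect x powr (1 - p)\<close> of the Jacobian cancels the
    density at \<open>reflect x\<close>; the other factor is the density at x.\<close>
  have eq: "\<bar>?d x\<bar> * ?F (reflect x) = g (reflect x) / x powr (1 - p)" if "x \<in> {a..b}" for x
  proof -
    have "0 < x" "0 < reflect x" using that reflect_mem[OF that] a_pos by auto
    then show ?thesis by (simp add: abs_mult powr_diff)
  qed
  have "(\<lambda>x. \<bar>?d x\<bar> * ?F (reflect x)) absolutely_integrable_on {a..b} \<and>
      integral {a..b} (\<lambda>x. \<bar>?d x\<bar> * ?F (reflect x)) = integral {a..b} ?F"
    using has_absolute_integral_change_of_variables_1'
      [of "{a..b}" reflect ?d ?F "integral {a..b} ?F"] assms
      DERIV_subset[OF reflect_derivative] inj_on_reflect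
    by (auto simp: reflect_image)
  then have *: "(\<lambda>x. g (reflect x) / x powr (1 - p)) absolutely_integrable_on {a..b}"
      "integral {a..b} (\<lambda>x. g (reflect x) / x powr (1 - p)) = integral {a..b} ?F"
    by (simp_all only: set_integrable_cong[OF refl refl eq, of "{a..b}" "\<lambda>x. x"]
      integral_cong[OF eq, of "{a..b}" "\<lambda>x. x"])
  show "set_integrable lebesgue {a..b} (\<lambda>x. g (reflect x) / x powr (1 - p))" by (fact *)
  show "(LINT x:{a..b}|lebesgue. g (reflect x) / x powr (1 - p)) =
      (LINT x:{a..b}|lebesgue. ?F x)"
    using * assms by (simp add: set_lebesgue_integral_eq_integral)
qed

section \<open>Continuity of p-convex functions and bounds for the transform\<close>

lemma p_convex_on_continuous_on:
  assumes h: "p_convex_on p {a..b} h"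
  shows "continuous_on {a<..<b} h"
proof -
  let ?g = "\<lambda>u. h (u powr (1 / p))"
  \<comment> \<open>p-convexity of h is ordinary convexity in u, and a convex function is continuous
    on an open interval. At the end points it may jump, hence \<open>{a<..<b}\<close>.\<close>
  have "convex_on {lo<..<hi} ?g"
  proof (intro convex_onI convex_real_interval)
    fix t u v :: real
    assume t: "0 < t" "t < 1" and uv: "u \<in> {lo<..<hi}" "v \<in> {lo<..<hi}"
    \<comment> \<open>\<open>convex_on\<close> is checked with the weight t on the second point,
      \<open>p_convex_on\<close> has it on the first; hence the instance
      \<open>1 - t\<close>.\<close>
    have "u powr (1 / p) \<in> {a..b}" "v powr (1 / p) \<in> {a..b}" "1 - t \<in> {0..1}"
      using uv t by (auto intro!: root_mem simp del: atLeastAtMost_iff) auto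
    with h have "h (((1 - t) * (u powr (1 / p)) powr p + (1 - (1 - t)) * (v powr (1 / p)) powr p)
        powr (1 / p)) \<le> (1 - t) * ?g u + (1 - (1 - t)) * ?g v"
      unfolding p_convex_on_def by blast
    moreover have "0 < u" "0 < v" using uv by (auto intro!: pos_if_lo_le simp del: min_le_iff_disj)
    ultimately show "?g ((1 - t) *\<^sub>R u + t *\<^sub>R v) \<le> (1 - t) * ?g u + t * ?g v"
      by (simp add: root_powr)
  qed
  then have "continuous_on {lo<..<hi} ?g"
    by (intro convex_on_continuous) auto
  moreover have "continuous_on {a<..<b} (\<lambda>x. x powr p)"
    using a_pos by (intro continuous_intros) auto
  moreover have "(\<lambda>x. x powr p) ` {a<..<b} \<subseteq> {lo<..<hi}"
    using powr_mem_open by blast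
  ultimately have "continuous_on {a<..<b} (\<lambda>x. ?g (x powr p))"
    by (rule continuous_on_compose2)
  then show ?thesis
    by (rule continuous_on_eq) (use a_pos powr_root in auto)
qed

lemma symm_transform_reflect:
  "p_symm_transform p a b f x = (f x + f (reflect x)) / 2"
  by (simp add: p_symm_transform_def reflect_def)

lemma symm_transform_bounds:
  assumes "symmetrized_p_convex_on p a b f" and x: "x \<in> {a..b}"
  shows "f (((a powr p + b powr p) / 2) powr (1 / p)) \<le> p_symm_transform p a b f x"
    and "p_symm_transform p a b f x \<le> (f a + f b) / 2"
proof -
  let ?P = "p_symm_transform p a b f"
  let ?m = "((a powr p + b powr p) / 2) powr (1 / p)"
  have conv: "?P ((t * y powr p + (1 - t) * z powr p) powr (1 / p)) \<le> t * ?P y + (1 - t) * ?P z"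
    if "y \<in> {a..b}" "z \<in> {a..b}" "t \<in> {0..1}" for y z t
    using assms(1) that unfolding symmetrized_p_convex_on_def p_convex_on_def by blast
  have m: "?m \<in> {a..b}" by (intro root_mem) auto
  have m_powr: "?m powr p = (a powr p + b powr p) / 2"
    using a_pos a_less_b by (intro root_powr) (simp add: add_pos_pos)
  \<comment> \<open>\<open>?m\<close> is a fixed point of \<open>reflect\<close>, so the transform
    agrees with f there.\<close>
  have "a powr p + b powr p - ?m powr p = (a powr p + b powr p) / 2"
    unfolding m_powr by (simp add: field_simps)
  then have "reflect ?m = ?m" by (simp only: reflect_def)
  then have "f ?m = ?P ?m" by (simp add: symm_transform_reflect)
  \<comment> \<open>The p-th powers of x and \<open>reflect x\<close> average to that of
    \<open>?m\<close>; this is p-convexity with t = 1/2.\<close>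
  also have "?P ?m \<le> (?P x + ?P (reflect x)) / 2"
    using conv[OF x reflect_mem[OF x], of "1 / 2"]
    by (simp add: reflect_powr[OF x] flip: add_divide_distrib)
  also have "?P (reflect x) = ?P x"
    using x by (simp add: symm_transform_reflect reflect_reflect)
  finally show "f ?m \<le> ?P x" by simp

  \<comment> \<open>The barycentric coordinate of \<open>x powr p\<close> between
    \<open>b powr p\<close> (t = 0) and \<open>a powr p\<close> (t = 1). Numerator and denominator
    never have opposite signs, whatever the sign of p.\<close>
  define t where "t = (x powr p - b powr p) / (a powr p - b powr p)"
  have ne: "a powr p \<noteq> b powr p"
    using powr_root[of a] powr_root[of b] a_pos a_less_b by force
  have t: "t \<in> {0..1}"
    using powr_mem[OF x] ne unfolding t_def
    by (auto simp: divide_simps min_def max_def split: if_splits)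
  have "t * (a powr p - b powr p) = x powr p - b powr p" using ne by (simp add: t_def)
  then have "t * a powr p + (1 - t) * b powr p = x powr p" by (simp add: algebra_simps)
  then have "?P x \<le> t * ?P a + (1 - t) * ?P b"
    using conv[of a b t] t x a_pos a_less_b by (simp add: powr_root)
  \<comment> \<open>\<open>reflect\<close> swaps a and b, so the transform has this same value at
    both.\<close>
  also have "\<dots> = (f a + f b) / 2"
    by (simp add: symm_transform_reflect reflect_ends field_simps)
  finally show "?P x \<le> (f a + f b) / 2" .
qed

section \<open>Integrability against the weight\<close>

lemma weight_integrable:
  fixes w :: "real \<Rightarrow> real"
  assumes "set_integrable lebesgue {a..b} w"
  shows "set_integrable lebesgue {a..b} (\<lambda>x. w x / x powr (1 - p))"
proof -
  have c: "continuous_on {a..b} (\<lambda>x. 1 / x powr (1 - p))"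
    using a_pos by (intro continuous_intros) auto
  \<comment> \<open>Since a > 0, the density is continuous on a compact interval, hence bounded and
    measurable.\<close>
  have "(\<lambda>x. 1 / x powr (1 - p) * w x) absolutely_integrable_on {a..b}"
    using assms c
    by (intro absolutely_integrable_bounded_measurable_product_real
        continuous_imp_measurable_on_sets_lebesgue compact_imp_bounded compact_continuous_image) auto
  then show ?thesis by simp
qed

text \<open>On the open interval the transform is measurable by continuity and bounded by the
  pointwise estimates, so its product with an integrable function is integrable. The two end points
  form a null set.\<close>

lemma symm_transform_integrable:
  assumes f: "symmetrized_p_convex_on p a b f"
    and w: "set_integrable lebesgue {a..b} w"
  shows "set_integrable lebesgue {a..b} (\<lambda>x. w x * p_symm_transform p a b f x / x powr (1 - p))"
proof -
  let ?P = "p_symm_transform p a b f"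
  let ?m = "((a powr p + b powr p) / 2) powr (1 / p)"
  have "?P \<in> borel_measurable (lebesgue_on {a<..<b})"
    using f p_convex_on_continuous_on unfolding symmetrized_p_convex_on_def
    by (intro continuous_imp_measurable_on_sets_lebesgue) auto
  moreover have "bounded (?P ` {a<..<b})"
    by (rule bounded_subset[OF bounded_closed_interval[of "f ?m" "(f a + f b) / 2"]])
       (use symm_transform_bounds[OF f] in auto)
  moreover have "(\<lambda>x. w x / x powr (1 - p)) absolutely_integrable_on {a<..<b}"
    using weight_integrable[OF w] by (rule set_integrable_subset) auto
  ultimately have "(\<lambda>x. ?P x * (w x / x powr (1 - p))) absolutely_integrable_on {a<..<b}"
    by (intro absolutely_integrable_bounded_measurable_product_real) auto
  then show ?thesis
    by (simp add: absolutely_integrable_on_Icc_iff_Ioo mult.commute)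
qed

end

theorem corollary2:
  fixes p a b :: real and f w :: "real \<Rightarrow> real"
  assumes "p \<noteq> 0" and "0 < a" and "a < b"
    and "symmetrized_p_convex_on p a b f"
    and "\<And>x. x \<in> {a..b} \<Longrightarrow> 0 \<le> w x"
    and "set_integrable lebesgue {a..b} w"
  shows
    "f (((a powr p + b powr p) / 2) powr (1 / p)) * (LINT x:{a..b}|lebesgue. w x / x powr (1 - p))
       \<le> (LINT x:{a..b}|lebesgue. w x * p_symm_transform p a b f x / x powr (1 - p))
     \<and> (LINT x:{a..b}|lebesgue. w x * p_symm_transform p a b f x / x powr (1 - p))
       \<le> (f a + f b) / 2 * (LINT x:{a..b}|lebesgue. w x / x powr (1 - p))
     \<and> (p_symmetric_on p a b w \<longrightarrow>
        set_integrable lebesgue {a..b} (\<lambda>x. w x * f x / x powr (1 - p)) \<longrightarrow>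
          f (((a powr p + b powr p) / 2) powr (1 / p)) * (LINT x:{a..b}|lebesgue. w x / x powr (1 - p))
            \<le> (LINT x:{a..b}|lebesgue. w x * f x / x powr (1 - p))
        \<and> (LINT x:{a..b}|lebesgue. w x * f x / x powr (1 - p))
            \<le> (f a + f b) / 2 * (LINT x:{a..b}|lebesgue. w x / x powr (1 - p)))"
proof -
  interpret p_interval p a b using assms(1-3) by unfold_locales
  let ?P = "p_symm_transform p a b f"
  let ?m = "((a powr p + b powr p) / 2) powr (1 / p)"
  let ?W = "\<lambda>x. w x / x powr (1 - p)"
  note sym = assms(4) and nonneg = assms(5)
  have W: "set_integrable lebesgue {a..b} ?W" by (rule weight_integrable) fact
  have WP: "set_integrable lebesgue {a..b} (\<lambda>x. w x * ?P x / x powr (1 - p))"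
    by (rule symm_transform_integrable) fact+
  have "f ?m * (LINT x:{a..b}|lebesgue. ?W x) = (LINT x:{a..b}|lebesgue. f ?m * ?W x)"
    by (simp only: set_integral_mult_right)
  also have "\<dots> \<le> (LINT x:{a..b}|lebesgue. w x * ?P x / x powr (1 - p))"
  proof (rule set_integral_mono)
    fix x assume x: "x \<in> {a..b}"
    have "f ?m * ?W x \<le> ?P x * ?W x"
      using symm_transform_bounds(1)[OF sym x] nonneg[OF x] by (intro mult_right_mono) auto
    then show "f ?m * ?W x \<le> w x * ?P x / x powr (1 - p)" by (simp add: mult.commute)
  qed (use set_integrable_mult_right[OF W] WP in blast)+
  finally have lower: "f ?m * (LINT x:{a..b}|lebesgue. ?W x) \<le>
      (LINT x:{a..b}|lebesgue. w x * ?P x / x powr (1 - p))" .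
  have "(LINT x:{a..b}|lebesgue. w x * ?P x / x powr (1 - p)) \<le>
      (LINT x:{a..b}|lebesgue. (f a + f b) / 2 * ?W x)"
  proof (rule set_integral_mono)
    fix x assume x: "x \<in> {a..b}"
    have "?P x * ?W x \<le> (f a + f b) / 2 * ?W x"
      using symm_transform_bounds(2)[OF sym x] nonneg[OF x] by (intro mult_right_mono) auto
    then show "w x * ?P x / x powr (1 - p) \<le> (f a + f b) / 2 * ?W x" by (simp add: mult.commute)
  qed (use set_integrable_mult_right[OF W] WP in blast)+
  also have "\<dots> = (f a + f b) / 2 * (LINT x:{a..b}|lebesgue. ?W x)"
    by (rule set_integral_mult_right)
  finally have upper: "(LINT x:{a..b}|lebesgue. w x * ?P x / x powr (1 - p)) \<le>
      (f a + f b) / 2 * (LINT x:{a..b}|lebesgue. ?W x)" .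
  \<comment> \<open>Once the two integrals agree, the second chain is the first one rewritten.
    Symmetrized p-convexity controls only the sum of f and its reflection, so f itself may be
    non-measurable; \<open>F\<close> is what allows the integral to be split.\<close>
  have "(LINT x:{a..b}|lebesgue. w x * ?P x / x powr (1 - p)) =
      (LINT x:{a..b}|lebesgue. w x * f x / x powr (1 - p))"
    if w: "p_symmetric_on p a b w"
      and F: "set_integrable lebesgue {a..b} (\<lambda>x. w x * f x / x powr (1 - p))"
  proof -
    let ?F = "\<lambda>x. w x * f x / x powr (1 - p)"
    let ?R = "\<lambda>x. w (reflect x) * f (reflect x) / x powr (1 - p)"
    note R = reflect_change_of_variables[of "\<lambda>x. w x * f x", OF F]
    have "w x * ?P x / x powr (1 - p) = 1 / 2 * (?F x + ?R x)" if "x \<in> {a..b}" for x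
    proof -
      \<comment> \<open>By symmetry the weight can be evaluated at the reflected point, which turns
        the second half of \<open>w x * ?P x\<close> into the reflection of
        \<open>w * f\<close>.\<close>
      have "w (reflect x) = w x"
        using w that by (simp add: p_symmetric_on_def reflect_def)
      then show ?thesis by (simp add: symm_transform_reflect add_divide_distrib distrib_left)
    qed
    then have "(LINT x:{a..b}|lebesgue. w x * ?P x / x powr (1 - p)) =
        (LINT x:{a..b}|lebesgue. 1 / 2 * (?F x + ?R x))"
      by (intro set_lebesgue_integral_cong) auto
    also have "\<dots> = 1 / 2 * ((LINT x:{a..b}|lebesgue. ?F x) + (LINT x:{a..b}|lebesgue. ?R x))"
      by (simp only: set_integral_mult_right set_integral_add(2)[OF F R(1)])
    also have "\<dots> = (LINT x:{a..b}|lebesgue. ?F x)"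
      unfolding R(2) by simp
    finally show ?thesis .
  qed
  with lower upper show ?thesis by auto
qed

end
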